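(* Let $0<q<1/2$. For all sufficiently large $k$ (depending only on $q$) the following holds. Let $H$ be a $k$-vertex graph such that for every two distinct $x,y\in V(H)$ at least $qk$ vertices of $V(H)\setminus\{x,y\}$ are adjacent to exactly one of $x,y$, and let $H'$ be an induced subgraph of $H$ on $k'\ge k-4$ vertices. Let $G$ be an $n$-vertex graph with $n\ge k$, and let $U\subseteq V(G)$ satisfy $|U|\le\gamma n$, where $0<\gamma<1$. Suppose that $0<\beta\le q/3$. Then there is a signature $T$ of $H$ with $T\subseteq V(H')$ and $t:=|T|\le(5/q)\log k$ such that, writing $r:=\lceil\beta k\rceil-t$ and $d_0:=k-k'+t$, one has $k'-t-r\ge1$, and the following statements hold. (1) If $r\ge1$, the number $N$ of embeddings $\vartheta:H'\hookrightarrow G$ satisfying $|\vartheta^{-1}(U)|\ge\beta k$ is at most $$N\le e^{3d_0}k^{d_0}\left(\frac{e^4\gamma k}{r}\right)^r\frac{\mathrm E_k(n)}{n^{k-k'}}.$$ (2) If, in addition, $\beta k\ge2t+2$ and $2e^4\gamma/\beta<1$, then $$N\le\exp\left(\frac{40}{q}(\log k)^2\right)\left(\frac{2e^4\gamma}{\beta}\right)^{\beta k/2}\frac{\mathrm E_k(n)}{n^{k-k'}}.$$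
   Context: All graphs are finite, simple and undirected; $\log$ is natural. An embedding $\vartheta:H'\hookrightarrow G$ is an injective map $V(H')\to V(G)$ preserving both adjacency and nonadjacency, and $\vartheta^{-1}(U)$ is the set of vertices of $H'$ mapped into $U$. A set $S\subseteq V(H)$ is a signature of $H$ if for every two distinct $u,v\in V(H)\setminus S$ there is $s\in S$ adjacent to exactly one of $u,v$. For integers $k\ge1$, $n\ge0$, $\mathrm E_k(n)=\max\{\prod_{i=1}^kn_i:\ n_i\in\mathbb Z_{\ge0},\ \sum_{i=1}^kn_i=n\}$. *)

theory Defs
  imports Complex_Main "HOL-Library.FuncSet"
begin

record 'a sgraph =
  verts :: "'a set"
  edges :: "'a set set"

definition simple_graph :: "'a sgraph \<Rightarrow> bool" where
  "simple_graph G \<longleftrightarrow> finite (verts G) \<and> (\<forall>e\<in>edges G. e \<subseteq> verts G \<and> card e = 2)"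

definition adj :: "'a sgraph \<Rightarrow> 'a \<Rightarrow> 'a \<Rightarrow> bool" where
  "adj G u v \<longleftrightarrow> {u, v} \<in> edges G"

definition induced_subgraph :: "'a sgraph \<Rightarrow> 'a sgraph \<Rightarrow> bool" where
  "induced_subgraph H' H \<longleftrightarrow>
     verts H' \<subseteq> verts H \<and> edges H' = {e \<in> edges H. e \<subseteq> verts H'}"

definition adj_exactly_one :: "'a sgraph \<Rightarrow> 'a \<Rightarrow> 'a \<Rightarrow> 'a \<Rightarrow> bool" where
  "adj_exactly_one G w u v \<longleftrightarrow> (adj G w u \<noteq> adj G w v)"

definition signature :: "'a sgraph \<Rightarrow> 'a set \<Rightarrow> bool" where
  "signature H S \<longleftrightarrow> S \<subseteq> verts H \<and>
     (\<forall>u \<in> verts H - S. \<forall>v \<in> verts H - S. u \<noteq> v \<longrightarrow> (\<exists>s\<in>S. adj_exactly_one H s u v))"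

text \<open>Embeddings are extensional functions (undefined outside the vertex set of the source),
  so that each map between the vertex sets is counted exactly once.\<close>

definition embeddings :: "'a sgraph \<Rightarrow> 'b sgraph \<Rightarrow> ('a \<Rightarrow> 'b) set" where
  "embeddings H G = {\<theta> \<in> verts H \<rightarrow>\<^sub>E verts G. inj_on \<theta> (verts H) \<and>
     (\<forall>u \<in> verts H. \<forall>v \<in> verts H. adj H u v \<longleftrightarrow> adj G (\<theta> u) (\<theta> v))}"

definition emb_preimage :: "'a sgraph \<Rightarrow> ('a \<Rightarrow> 'b) \<Rightarrow> 'b set \<Rightarrow> 'a set" where
  "emb_preimage H \<theta> U = {x \<in> verts H. \<theta> x \<in> U}"

definition maxprod_set :: "nat \<Rightarrow> nat \<Rightarrow> nat set" where
  "maxprod_set k n = {(\<Prod>i=1..k. m i) | m :: nat \<Rightarrow> nat. (\<Sum>i=1..k. m i) = n}"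

definition maxprod :: "nat \<Rightarrow> nat \<Rightarrow> nat" where
  "maxprod k n = Max (maxprod_set k n)"

text \<open>For \<open>k \<ge> 1\<close> the maximum is over a finite nonempty set.\<close>

lemma finite_maxprod_set: "finite (maxprod_set k n)"
proof (rule finite_subset)
  show "maxprod_set k n \<subseteq> {..n ^ k}"
  proof
    fix p assume "p \<in> maxprod_set k n"
    then obtain m :: "nat \<Rightarrow> nat" where m: "p = (\<Prod>i=1..k. m i)" "(\<Sum>i=1..k. m i) = n"
      by (auto simp: maxprod_set_def)
    have "m i \<le> n" if "i \<in> {1..k}" for i
      using member_le_sum[of i "{1..k}" m] that m(2) by simp
    then have "(\<Prod>i=1..k. m i) \<le> (\<Prod>i=1..k. n)"
      by (intro prod_mono) auto
    then show "p \<in> {..n ^ k}" using m(1) by simp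
  qed
qed simp

lemma maxprod_set_nonempty: "k \<ge> 1 \<Longrightarrow> maxprod_set k n \<noteq> {}"
proof -
  assume "k \<ge> 1"
  then have "(\<Sum>i=1..k. if i = 1 then n else 0) = n"
    by simp
  then show ?thesis
    unfolding maxprod_set_def by blast
qed

end

theory Submission
  imports Defs
begin

text \<open>
  The embeddings are counted by exposing them in three stages. Let \<open>T\<close> be a small signature of
  \<open>H\<close> inside \<open>H'\<close>. Once the restriction of an embedding \<open>\<theta>\<close> to \<open>T\<close> is fixed, each vertex of
  \<open>G\<close> has a definite adjacency pattern to \<open>\<theta>(T)\<close>, and since different vertices of \<open>H' - T\<close> have
  different patterns to \<open>T\<close>, every vertex of \<open>G\<close> can be the image of at most one vertex of
  \<open>H' - T\<close>. The candidate sets of the vertices of \<open>H' - T\<close> are thus pairwise disjoint.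

  An embedding with at least \<open>\<beta>k\<close> vertices in \<open>U\<close> sends at least \<open>r\<close> vertices of \<open>H' - T\<close>
  into \<open>U\<close>. One can therefore choose \<open>\<theta>\<close> on \<open>T\<close> (at most \<open>n\<^sup>t\<close> ways), then an \<open>r\<close>-subset \<open>S\<close> of
  \<open>U\<close> contained in the image (a binomial coefficient, at most \<open>(e\<gamma>n/r)\<^sup>r\<close>). By disjointness \<open>S\<close>
  already determines which \<open>r\<close> vertices are sent to it, and how; choosing a subset of \<open>U\<close>
  rather than a set of \<open>r\<close> vertices of \<open>H'\<close> and then their images saves a factor that would be
  too large. The remaining \<open>m = k' - t - r\<close> vertices are mapped into disjoint sets of total size
  at most \<open>n\<close>, in at most \<open>E\<^sub>m(n)\<close> ways. This is \<open>card_embeddings_meeting_U_le\<close>.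

  It remains to compare \<open>E\<^sub>m(n)\<close> with \<open>E\<^sub>k(n)\<close>. The comparison with \<open>(n/k)\<^sup>k\<close> would be
  exponentially lossy when \<open>n\<close> is of the order of \<open>k\<close>, so parts are added one at a time:
  halving a part of at least average size in an optimal partition gives \<open>n E\<^sub>m(n) \<le> (16/3) k E\<^sub>m\<^sub>+\<^sub>1(n)\<close> for
  \<open>m < k \<le> n\<close> (\<open>maxprod_Suc\<close>), and \<open>16/3 \<le> e\<^sup>3\<close>. With \<open>k - m = d\<^sub>0 + r\<close> steps this is exactly
  the first bound. The second follows from the first since \<open>r \<ge> \<beta>k/2\<close> and
  \<open>d\<^sub>0 = O(log k / q)\<close>.

  The signature comes from a greedy choice (\<open>small_signature\<close>): a vertex of \<open>H'\<close> separates on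
  average at least a fraction \<open>q/2\<close> of the pairs, so after about \<open>(4/q) log k\<close> choices fewer than
  one of the at most \<open>k\<^sup>2\<close> pairs is left.
\<close>

section \<open>Small signatures\<close>

text \<open>Double counting: if every item is hit by a fraction \<open>\<rho>\<close> of \<open>X\<close>, then for every set of
  items some single element of \<open>X\<close> hits a fraction \<open>\<rho>\<close> of them. The greedy choice of such
  elements therefore leaves at most a fraction \<open>1 - \<rho>\<close> unhit at each step.\<close>

lemma greedy_hitting_set:
  fixes hits :: "'a \<Rightarrow> 'p \<Rightarrow> bool" and \<rho> :: real
  assumes "finite X" "X \<noteq> {}" "finite P" "\<rho> \<le> 1"
    and many: "\<And>p. p \<in> P \<Longrightarrow> \<rho> * card X \<le> card {x \<in> X. hits x p}"
  shows "\<exists>T\<subseteq>X. card T \<le> t \<and>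
    real (card {p \<in> P. \<forall>x\<in>T. \<not> hits x p}) \<le> card P * (1 - \<rho>) ^ t"
proof (induction t)
  case 0
  show ?case by (rule exI[of _ "{}"]) simp
next
  case (Suc t)
  then obtain T where T: "T \<subseteq> X" "card T \<le> t"
    and bound: "real (card {p \<in> P. \<forall>x\<in>T. \<not> hits x p}) \<le> card P * (1 - \<rho>) ^ t"
    by blast
  define Q where "Q = {p \<in> P. \<forall>x\<in>T. \<not> hits x p}"
  have Q: "finite Q" "Q \<subseteq> P"
    using \<open>finite P\<close> by (auto simp: Q_def)
  have "\<exists>x\<in>X. \<rho> * card Q \<le> card {p \<in> Q. hits x p}"
  proof (rule ccontr)
    assume "\<not> ?thesis"
    then have "(\<Sum>x\<in>X. real (card {p \<in> Q. hits x p})) < (\<Sum>x\<in>X. \<rho> * card Q)"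
      using \<open>finite X\<close> \<open>X \<noteq> {}\<close> by (intro sum_strict_mono) (auto simp: not_le)
    also have "\<dots> = (\<Sum>p\<in>Q. \<rho> * card X)"
      by simp
    also have "\<dots> \<le> (\<Sum>p\<in>Q. real (card {x \<in> X. hits x p}))"
      using many Q by (intro sum_mono) auto
    also have "\<dots> = (\<Sum>x\<in>X. real (card {p \<in> Q. hits x p}))"
      using sum.swap_restrict[OF \<open>finite X\<close> Q(1), of "\<lambda>_ _. 1::real" hits] by simp
    finally show False by simp
  qed
  then obtain x where x: "x \<in> X" "\<rho> * card Q \<le> card {p \<in> Q. hits x p}"
    by blast
  have "{p \<in> P. \<forall>y\<in>insert x T. \<not> hits y p} = Q - {p \<in> Q. hits x p}"
    by (auto simp: Q_def)
  then have "real (card {p \<in> P. \<forall>y\<in>insert x T. \<not> hits y p}) = card Q - card {p \<in> Q. hits x p}"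
    using Q(1) by (simp add: card_Diff_subset of_nat_diff card_mono)
  also have "\<dots> \<le> card Q * (1 - \<rho>)"
    using x by (simp add: algebra_simps of_nat_diff card_mono Q(1))
  also have "\<dots> \<le> card P * (1 - \<rho>) ^ Suc t"
    using mult_right_mono[OF bound, of "1 - \<rho>"] \<open>\<rho> \<le> 1\<close> by (simp add: Q_def algebra_simps)
  finally have "real (card {p \<in> P. \<forall>y\<in>insert x T. \<not> hits y p}) \<le> card P * (1 - \<rho>) ^ Suc t" .
  moreover have "card (insert x T) \<le> Suc t"
    using T card_insert_le_m1[of "Suc t" T x] by simp
  ultimately show ?case
    using T(1) x(1) by (intro exI[of _ "insert x T"]) auto
qed

text \<open>The greedy choice is applied to the ordered pairs of distinct vertices. Passing from \<open>H\<close>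
  to \<open>H'\<close> costs a pair at most four of its separating vertices, which \<open>k \<ge> 8/q\<close> absorbs by
  halving \<open>q\<close>.\<close>

lemma small_signature:
  fixes H H' :: "'a sgraph" and q :: real
  assumes "0 < q" "q < 1/2" "simple_graph H" "card (verts H) = k" "8 / q \<le> k"
    and sep: "\<And>x y. \<lbrakk>x \<in> verts H; y \<in> verts H; x \<noteq> y\<rbrakk> \<Longrightarrow>
      q * k \<le> card {w \<in> verts H - {x, y}. adj_exactly_one H w x y}"
    and sub: "verts H' \<subseteq> verts H" and big: "k \<le> card (verts H') + 4"
  shows "\<exists>T\<subseteq>verts H'. signature H T \<and> real (card T) \<le> (5 / q) * ln k"
proof -
  define X where "X = verts H'"
  define P where "P = {(x, y). x \<in> verts H \<and> y \<in> verts H \<and> x \<noteq> y}"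
  define hits where "hits = (\<lambda>w (x, y). w \<notin> {x, y} \<and> adj_exactly_one H w x y)"
  have "8 / q > 16"
    using assms(1,2) by (simp add: field_simps)
  then have k16: "k > 16"
    using assms(5) by linarith
  have fin: "finite (verts H)" "finite X"
    using assms(3) sub by (auto simp: simple_graph_def X_def finite_subset)
  have "P \<subseteq> verts H \<times> verts H"
    by (auto simp: P_def)
  then have P: "finite P" "card P \<le> k\<^sup>2"
    using fin(1) card_mono[of "verts H \<times> verts H" P] assms(4)
    by (auto intro: finite_subset simp: card_cartesian_product power2_eq_square)
  have "X \<noteq> {}"
    using big k16 by (auto simp: X_def)
  have cX: "card X \<le> k"
    using card_mono[OF fin(1) sub] assms(4) by (simp add: X_def)
  have many: "q / 2 * card X \<le> card {w \<in> X. hits w p}" if "p \<in> P" for p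
  proof -
    obtain x y where p: "p = (x, y)" "x \<in> verts H" "y \<in> verts H" "x \<noteq> y"
      using \<open>p \<in> P\<close> by (auto simp: P_def)
    let ?D = "{w \<in> verts H - {x, y}. adj_exactly_one H w x y}"
    have "?D \<subseteq> {w \<in> X. hits w p} \<union> (verts H - X)"
      by (auto simp: hits_def p)
    then have "card ?D \<le> card ({w \<in> X. hits w p} \<union> (verts H - X))"
      using fin by (intro card_mono) auto
    also have "\<dots> \<le> card {w \<in> X. hits w p} + card (verts H - X)"
      by (rule card_Un_le)
    also have "card (verts H - X) \<le> 4"
      using sub big fin assms(4) by (simp add: X_def card_Diff_subset)
    finally have "real (card ?D) \<le> card {w \<in> X. hits w p} + 4"
      by linarith
    then have "q * k - 4 \<le> card {w \<in> X. hits w p}"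
      using sep[OF p(2-4)] by linarith
    moreover have "4 \<le> q / 2 * k"
      using assms(1,5) by (simp add: field_simps)
    moreover have "q / 2 * card X \<le> q / 2 * k"
      using assms(1) cX by (intro mult_left_mono) auto
    ultimately show ?thesis by linarith
  qed
  \<comment> \<open>Smallest number of steps for which \<open>k\<^sup>2 e\<^bsup>-qt/2\<^esup> < 1\<close> is guaranteed.\<close>
  define t where "t = Suc (nat \<lfloor>4 * ln k / q\<rfloor>)"
  have lnk: "1 \<le> ln (real k)"
    using k16 exp_le by (subst ln_ge_iff) auto
  obtain T where T: "T \<subseteq> X" "card T \<le> t"
    and unhit: "real (card {p \<in> P. \<forall>x\<in>T. \<not> hits x p}) \<le> card P * (1 - q / 2) ^ t"
    using greedy_hitting_set[where \<rho> = "q / 2" and hits = hits and t = t, OF fin(2) \<open>X \<noteq> {}\<close> P(1) _ many]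
      assms(2) by auto
  have "4 * ln k / q \<ge> 0"
    using lnk assms(1) by simp
  then have t: "4 * ln k / q < t" "t \<le> 4 * ln k / q + 1"
    unfolding t_def by linarith+
  have "card P * (1 - q / 2) ^ t \<le> real k ^ 2 * exp (- q / 2) ^ t"
  proof (intro mult_mono power_mono)
    show "1 - q / 2 \<le> exp (- q / 2)"
      using exp_ge_add_one_self[of "- q / 2"] by simp
    show "real (card P) \<le> real k ^ 2"
      using P(2) by (metis of_nat_le_iff of_nat_power)
  qed (use assms in auto)
  also have "\<dots> = exp (2 * ln k - q / 2 * t)"
  proof -
    have "real k ^ 2 = exp (2 * ln k)"
      using k16 exp_of_nat_mult[of 2 "ln (real k)"] by simp
    moreover have "exp (- q / 2) ^ t = exp (- (q / 2 * t))"
      using exp_of_nat_mult[of t "- q / 2"] by (simp add: mult.commute)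
    ultimately show ?thesis
      by (simp only: diff_conv_add_uminus exp_add)
  qed
  also have "\<dots> < 1"
    using t(1) assms(1) by (simp add: field_simps)
  finally have "card {p \<in> P. \<forall>x\<in>T. \<not> hits x p} < 1"
    using unhit by linarith
  then have all_hit: "{p \<in> P. \<forall>x\<in>T. \<not> hits x p} = {}"
    using P(1) by simp
  have "signature H T"
    unfolding signature_def
  proof (intro conjI ballI impI)
    show "T \<subseteq> verts H"
      using T(1) sub by (auto simp: X_def)
    fix u v assume "u \<in> verts H - T" "v \<in> verts H - T" "u \<noteq> v"
    then have "(u, v) \<in> P"
      by (auto simp: P_def)
    then show "\<exists>s\<in>T. adj_exactly_one H s u v"
      using all_hit by (auto simp: hits_def)
  qed
  moreover have "real (card T) \<le> (5 / q) * ln k"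
  proof -
    have "real (card T) \<le> 4 * ln k / q + 1"
      using T(2) t(2) by linarith
    also have "1 \<le> ln k / q"
      using lnk assms(1,2) by (simp add: field_simps)
    finally show ?thesis by (simp add: field_simps)
  qed
  ultimately show ?thesis
    using T(1) by (auto simp: X_def)
qed

section \<open>The maximal product of parts\<close>

text \<open>The sum may fall short of \<open>n\<close>: the missing amount is added to one of the factors.\<close>

lemma prod_le_maxprod:
  assumes "finite A" "card A = m" "m \<ge> 1" "(\<Sum>v\<in>A. c v) \<le> n"
  shows "(\<Prod>v\<in>A. c v) \<le> maxprod m n"
proof -
  obtain h where h: "bij_betw h {1..m} A"
    using assms(1,2) ex_bij_betw_nat_finite_1 by blast
  define f where "f = (\<lambda>i. c (h i) + (if i = 1 then n - (\<Sum>v\<in>A. c v) else 0))"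
  have "(\<Sum>i=1..m. f i) = (\<Sum>i=1..m. c (h i)) + (n - (\<Sum>v\<in>A. c v))"
    using assms(3) by (simp add: f_def sum.distrib)
  also have "(\<Sum>i=1..m. c (h i)) = (\<Sum>v\<in>A. c v)"
    using h by (rule sum.reindex_bij_betw)
  finally have "(\<Sum>i=1..m. f i) = n"
    using assms(4) by simp
  then have "(\<Prod>i=1..m. f i) \<in> maxprod_set m n"
    by (auto simp: maxprod_set_def)
  then have "(\<Prod>i=1..m. f i) \<le> maxprod m n"
    unfolding maxprod_def by (intro Max_ge finite_maxprod_set)
  moreover have "(\<Prod>i=1..m. c (h i)) \<le> (\<Prod>i=1..m. f i)"
    by (intro prod_mono) (auto simp: f_def)
  moreover have "(\<Prod>i=1..m. c (h i)) = (\<Prod>v\<in>A. c v)"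
    using h by (rule prod.reindex_bij_betw)
  ultimately show ?thesis by simp
qed

lemma maxprod_attained:
  assumes "m \<ge> 1"
  obtains f :: "nat \<Rightarrow> nat" where "maxprod m n = (\<Prod>i=1..m. f i)" "(\<Sum>i=1..m. f i) = n"
  using Max_in[OF finite_maxprod_set maxprod_set_nonempty[OF assms], of n]
  by (auto simp: maxprod_def maxprod_set_def)

text \<open>The halves of \<open>x\<close> have product at least \<open>(x\<^sup>2 - 1)/4\<close>, and \<open>x\<^sup>2 - 1 \<ge> 3x\<^sup>2/4\<close>
  from \<open>x = 2\<close> on.\<close>

lemma halves_product:
  assumes "x \<ge> (2::nat)"
  shows "3 * x * x \<le> 16 * ((x div 2) * (x - x div 2))"
proof -
  obtain a where a: "x = 2 * a \<or> x = Suc (2 * a)"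
    by (metis oddE evenE Suc_eq_plus1)
  moreover have "a \<ge> 1"
    using a assms by auto
  moreover have "a * a \<ge> a"
    by simp
  ultimately show ?thesis
    by (auto simp: algebra_simps)
qed

text \<open>Some part \<open>x\<close> of an optimal partition into \<open>m\<close> parts is at least \<open>n/m > 1\<close>, so
  \<open>x \<ge> 2\<close>, and splitting it in halves multiplies the product by at least
  \<open>3x/16 \<ge> 3n/(16k)\<close>.\<close>

lemma maxprod_Suc:
  assumes "1 \<le> m" "m < k" "k \<le> n"
  shows "3 * n * maxprod m n \<le> 16 * k * maxprod (Suc m) n"
proof -
  obtain f where f: "maxprod m n = (\<Prod>i=1..m. f i)" "(\<Sum>i=1..m. f i) = n"
    using maxprod_attained[OF assms(1)] by blast
  obtain i where i: "i \<in> {1..m}" "n \<le> m * f i"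
  proof -
    have "\<exists>i\<in>{1..m}. n \<le> m * f i"
    proof (rule ccontr)
      assume "\<not> ?thesis"
      then have "(\<Sum>i=1..m. m * f i) < (\<Sum>i=1..m. n)"
        using assms(1) by (intro sum_strict_mono) (auto simp: not_le)
      then show False
        using f(2) by (simp flip: sum_distrib_left)
    qed
    then show thesis using that by blast
  qed
  define x where "x = f i"
  define Q where "Q = (\<Prod>j\<in>{1..m}-{i}. f j)"
  have x: "n \<le> k * x" "x \<ge> 2"
  proof -
    show "n \<le> k * x"
      using i(2) assms(2) mult_le_mono1[of m k x] unfolding x_def by linarith
    have "m * 1 < m * x"
      using i(2) assms unfolding x_def by linarith
    then show "x \<ge> 2"
      using mult_less_cancel1[of m 1 x] by linarith
  qed
  have P: "maxprod m n = x * Q"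
    using i(1) f(1) prod.remove[of "{1..m}" i f] by (simp add: x_def Q_def)
  define g where "g = f(i := x div 2, Suc m := x - x div 2)"
  have split: "{1..Suc m} = insert (Suc m) (insert i ({1..m} - {i}))"
    using i(1) by auto
  have ne: "i \<noteq> Suc m" "Suc m \<notin> {1..m}"
    using i(1) by auto
  have rest: "sum g ({1..m} - {i}) = sum f ({1..m} - {i})"
    "prod g ({1..m} - {i}) = prod f ({1..m} - {i})"
    by (auto simp: g_def intro!: sum.cong prod.cong)
  have gi: "g i = x div 2" "g (Suc m) = x - x div 2"
    using ne(1) by (auto simp: g_def)
  have "(\<Sum>j=1..Suc m. g j) = x + (\<Sum>j\<in>{1..m}-{i}. f j)"
    unfolding split using ne by (simp add: rest gi del: insert_Diff_single One_nat_def)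
  also have "\<dots> = n"
    using i(1) f(2) sum.remove[of "{1..m}" i f] by (simp add: x_def)
  finally have "(\<Sum>j=1..Suc m. g j) = n" .
  then have "(\<Prod>j=1..Suc m. g j) \<le> maxprod (Suc m) n"
    by (intro prod_le_maxprod) auto
  moreover have "(\<Prod>j=1..Suc m. g j) = (x div 2) * (x - x div 2) * Q"
    unfolding split using ne by (simp add: rest gi Q_def del: insert_Diff_single One_nat_def)
  ultimately have new: "(x div 2) * (x - x div 2) * Q \<le> maxprod (Suc m) n"
    by simp
  have "3 * n * maxprod m n \<le> 3 * (k * x) * (x * Q)"
    unfolding P by (intro mult_le_mono x order.refl)
  also have "\<dots> = k * (3 * x * x) * Q"
    by simp
  also have "\<dots> \<le> k * (16 * ((x div 2) * (x - x div 2))) * Q"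
    by (intro mult_le_mono halves_product x order.refl)
  also have "\<dots> = 16 * k * ((x div 2) * (x - x div 2) * Q)"
    by simp
  also have "\<dots> \<le> 16 * k * maxprod (Suc m) n"
    by (intro mult_le_mono new order.refl)
  finally show ?thesis .
qed

text \<open>The constant \<open>16/3\<close> is weakened to \<open>e\<^sup>3\<close>, the form in which it enters the final bound.\<close>

lemma maxprod_add:
  fixes k :: nat
  assumes "1 \<le> m" "k \<le> n" "m + j \<le> k"
  shows "real n ^ j * maxprod m n \<le> (exp 3 * k) ^ j * maxprod (m + j) n"
  using assms(3)
proof (induction j)
  case (Suc j)
  have step: "n * maxprod (m + j) n \<le> (exp 3 * k) * maxprod (m + Suc j) n"
  proof -
    have "real (3 * n * maxprod (m + j) n) \<le> real (16 * k * maxprod (Suc (m + j)) n)"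
      using assms Suc.prems by (intro of_nat_mono maxprod_Suc) auto
    then have "n * maxprod (m + j) n \<le> 16 / 3 * (real k * maxprod (m + Suc j) n)"
      by simp
    also have "16 / 3 \<le> exp (3 :: real)"
      using exp_lower_Taylor_quadratic[of 3] by simp
    finally show ?thesis
      by (simp add: mult.assoc mult_right_mono)
  qed
  have "real n ^ Suc j * maxprod m n = n * (real n ^ j * maxprod m n)"
    by simp
  also have "\<dots> \<le> n * ((exp 3 * k) ^ j * maxprod (m + j) n)"
    using Suc by (intro mult_left_mono) auto
  also have "\<dots> = (exp 3 * k) ^ j * (n * maxprod (m + j) n)"
    by simp
  also have "\<dots> \<le> (exp 3 * k) ^ j * ((exp 3 * k) * maxprod (m + Suc j) n)"
    by (intro mult_left_mono step) auto
  finally show ?case by (simp add: mult_ac)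
qed simp

section \<open>Counting embeddings that meet a given set\<close>

text \<open>The embeddings are grouped by their restriction \<open>\<phi>\<close> to \<open>T\<close> and by an \<open>r\<close>-set \<open>S \<subseteq> U\<close>
  covered by the image of \<open>verts H - T\<close>. Within one group \<open>F \<phi> S\<close> all embeddings use the same
  vertices to cover \<open>S\<close>, in the same way, because a vertex of \<open>G\<close> fits the adjacency pattern of
  at most one vertex outside \<open>T\<close>. The other \<open>m\<close> vertices are free only within disjoint
  candidate sets.\<close>

lemma card_embeddings_meeting_U_le:
  fixes H :: "'a sgraph" and G :: "'b sgraph"
  assumes fin: "finite (verts H)" "finite (verts G)" and n: "card (verts G) = n"
    and T: "signature H T" "card T = t"
    and U: "U \<subseteq> verts G"
    and m: "card (verts H) = t + r + m" "m \<ge> 1"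
  shows "card {\<theta> \<in> embeddings H G. r \<le> card (emb_preimage H \<theta> U - T)}
    \<le> n ^ t * (card U choose r) * maxprod m n"
proof -
  define V where "V = verts H - T"
  define F where "F = (\<lambda>\<phi> S. {\<theta> \<in> embeddings H G. restrict \<theta> T = \<phi> \<and> S \<subseteq> \<theta> ` V})"
  define \<S> where "\<S> = {S. S \<subseteq> U \<and> card S = r}"
  have TH: "T \<subseteq> verts H" and finT: "finite T" and finU: "finite U"
    using T(1) fin U by (auto simp: signature_def finite_subset)
  have VH: "V \<subseteq> verts H" "finite V" "card V = r + m"
    using fin(1) TH T(2) m(1) finT by (auto simp: V_def card_Diff_subset)
  have finE: "finite (embeddings H G)"
    using fin by (auto simp: embeddings_def intro!: finite_PiE)
  have F_le: "card (F \<phi> S) \<le> maxprod m n" if "S \<in> \<S>" for \<phi> S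
  proof (cases "F \<phi> S = {}")
    case False
    then obtain \<theta>\<^sub>0 where \<theta>\<^sub>0: "\<theta>\<^sub>0 \<in> F \<phi> S"
      by blast
    define C where "C = (\<lambda>v. {w \<in> verts G. \<forall>s\<in>T. adj G (\<phi> s) w \<longleftrightarrow> adj H s v})"
    \<comment> \<open>The vertices covering \<open>S\<close>; \<open>on_R\<close> below shows that they do not depend on \<open>\<theta>\<^sub>0\<close>.\<close>
    define R where "R = {v \<in> V. \<theta>\<^sub>0 v \<in> S}"
    define B where "B = V - R"
    have in_C: "\<theta> v \<in> C v" if "\<theta> \<in> F \<phi> S" "v \<in> V" for \<theta> v
    proof -
      have "v \<in> verts H" and \<theta>: "\<theta> \<in> embeddings H G" and \<phi>: "\<phi> = restrict \<theta> T"
        using that VH(1) by (auto simp: F_def)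
      moreover have "adj G (\<theta> s) (\<theta> v) \<longleftrightarrow> adj H s v" if "s \<in> T" for s
        using that \<theta> TH \<open>v \<in> verts H\<close> by (auto simp: embeddings_def)
      ultimately show ?thesis
        by (auto simp: C_def embeddings_def)
    qed
    have C_disj: "v = v'" if w: "w \<in> C v" "w \<in> C v'" and v: "v \<in> V" "v' \<in> V" for v v' w
    proof (rule ccontr)
      assume "v \<noteq> v'"
      then obtain s where "s \<in> T" "adj H s v \<noteq> adj H s v'"
        using v T(1) unfolding V_def signature_def adj_exactly_one_def by blast
      then show False
        using w by (auto simp: C_def)
    qed
    have on_R: "\<theta> v = \<theta>\<^sub>0 v" if "\<theta> \<in> F \<phi> S" "v \<in> R" for \<theta> v
    proof -
      have v: "v \<in> V" "\<theta>\<^sub>0 v \<in> S"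
        using \<open>v \<in> R\<close> by (auto simp: R_def)
      then obtain v' where v': "v' \<in> V" "\<theta>\<^sub>0 v = \<theta> v'"
        using \<open>\<theta> \<in> F \<phi> S\<close> by (auto simp: F_def)
      have "v = v'"
        using C_disj[of "\<theta>\<^sub>0 v" v v'] in_C[OF \<theta>\<^sub>0 v(1)] in_C[OF \<open>\<theta> \<in> F \<phi> S\<close> v'(1)] v(1) v' by simp
      then show ?thesis using v'(2) by simp
    qed
    have "inj_on \<theta>\<^sub>0 R"
      using \<theta>\<^sub>0 VH(1) by (auto simp: F_def embeddings_def R_def intro: inj_on_subset)
    moreover have "\<theta>\<^sub>0 ` R = S"
      using \<theta>\<^sub>0 by (auto simp: F_def R_def)
    ultimately have "card R = r"
      using card_image[of \<theta>\<^sub>0 R] \<open>S \<in> \<S>\<close> by (simp add: \<S>_def)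
    moreover have R: "R \<subseteq> V" "finite R"
      using VH(2) by (auto simp: R_def)
    ultimately have B: "B \<subseteq> V" "finite B" "card B = m"
      using VH by (auto simp: B_def card_Diff_subset)
    have finC: "finite (C v)" for v
      using fin(2) by (simp add: C_def)
    have "inj_on (\<lambda>\<theta>. restrict \<theta> B) (F \<phi> S)"
    proof (rule inj_onI, rule ext)
      fix \<theta> \<theta>' v assume \<theta>: "\<theta> \<in> F \<phi> S" "\<theta>' \<in> F \<phi> S" and eq: "restrict \<theta> B = restrict \<theta>' B"
      consider "v \<in> T" | "v \<in> R" | "v \<in> B" | "v \<notin> verts H"
        by (auto simp: B_def V_def)
      then show "\<theta> v = \<theta>' v"
      proof cases
        case 1
        have "restrict \<theta> T = restrict \<theta>' T"
          using \<theta> by (simp add: F_def)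
        from fun_cong[OF this, of v] show ?thesis using 1 by simp
      next
        case 2
        show ?thesis using on_R[OF \<theta>(1) 2] on_R[OF \<theta>(2) 2] by (simp only:)
      next
        case 3
        from fun_cong[OF eq, of v] show ?thesis using 3 by simp
      next
        case 4
        have ext: "\<theta> \<in> extensional (verts H)" "\<theta>' \<in> extensional (verts H)"
          using \<theta> by (auto simp: F_def embeddings_def PiE_def)
        show ?thesis using extensional_arb[OF ext(1) 4] extensional_arb[OF ext(2) 4] by (simp only:)
      qed
    qed
    moreover have "(\<lambda>\<theta>. restrict \<theta> B) ` F \<phi> S \<subseteq> Pi\<^sub>E B C"
      using in_C B(1) by auto
    ultimately have "card (F \<phi> S) \<le> card (Pi\<^sub>E B C)"
      using B(2) finC by (intro card_inj_on_le[of "\<lambda>\<theta>. restrict \<theta> B"] finite_PiE) auto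
    also have "\<dots> = (\<Prod>v\<in>B. card (C v))"
      using B(2) by (rule card_PiE)
    also have "\<dots> \<le> maxprod m n"
    proof (rule prod_le_maxprod[OF B(2,3) m(2)])
      have "(\<Sum>v\<in>B. card (C v)) = card (\<Union>v\<in>B. C v)"
        using B(1,2) finC C_disj by (intro card_UN_disjoint[symmetric]) blast+
      also have "\<dots> \<le> n"
        unfolding n[symmetric] using fin(2) by (intro card_mono) (auto simp: C_def)
      finally show "(\<Sum>v\<in>B. card (C v)) \<le> n" .
    qed
    finally show ?thesis .
  qed simp
  have cover: "{\<theta> \<in> embeddings H G. r \<le> card (emb_preimage H \<theta> U - T)}
    \<subseteq> (\<Union>(\<phi>, S) \<in> (T \<rightarrow>\<^sub>E verts G) \<times> \<S>. F \<phi> S)"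
  proof
    fix \<theta> assume "\<theta> \<in> {\<theta> \<in> embeddings H G. r \<le> card (emb_preimage H \<theta> U - T)}"
    then have \<theta>: "\<theta> \<in> embeddings H G" "r \<le> card (emb_preimage H \<theta> U - T)"
      by auto
    obtain R where R: "R \<subseteq> emb_preimage H \<theta> U - T" "card R = r"
      using obtain_subset_with_card_n[OF \<theta>(2)] by blast
    have "R \<subseteq> V"
      using R(1) by (auto simp: emb_preimage_def V_def)
    moreover from this have "inj_on \<theta> R"
      using \<theta>(1) VH(1) by (auto simp: embeddings_def intro: inj_on_subset)
    ultimately have "\<theta> ` R \<in> \<S>" "\<theta> ` R \<subseteq> \<theta> ` V"
      using R by (auto simp: \<S>_def emb_preimage_def card_image)
    moreover have "restrict \<theta> T \<in> T \<rightarrow>\<^sub>E verts G"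
      using \<theta>(1) TH by (auto simp: embeddings_def)
    ultimately show "\<theta> \<in> (\<Union>(\<phi>, S) \<in> (T \<rightarrow>\<^sub>E verts G) \<times> \<S>. F \<phi> S)"
      using \<theta>(1) by (auto simp: F_def)
  qed
  have fin_index: "finite ((T \<rightarrow>\<^sub>E verts G) \<times> \<S>)"
    using finT fin(2) finU by (auto simp: \<S>_def intro!: finite_PiE)
  have "card {\<theta> \<in> embeddings H G. r \<le> card (emb_preimage H \<theta> U - T)}
    \<le> card (\<Union>(\<phi>, S) \<in> (T \<rightarrow>\<^sub>E verts G) \<times> \<S>. F \<phi> S)"
    using finE fin_index by (intro card_mono[OF _ cover] finite_UN_I) (auto simp: F_def)
  also have "\<dots> \<le> (\<Sum>(\<phi>, S) \<in> (T \<rightarrow>\<^sub>E verts G) \<times> \<S>. card (F \<phi> S))"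
    using card_UN_le[OF fin_index, of "\<lambda>(\<phi>, S). F \<phi> S"] by (simp add: case_prod_beta)
  also have "\<dots> \<le> (\<Sum>(\<phi>, S) \<in> (T \<rightarrow>\<^sub>E verts G) \<times> \<S>. maxprod m n)"
    using F_le by (intro sum_mono) auto
  also have "\<dots> = n ^ t * (card U choose r) * maxprod m n"
    using finT finU T(2) n
    by (simp add: case_prod_beta card_cartesian_product card_PiE \<S>_def n_subsets)
  finally show ?thesis .
qed

section \<open>Estimates\<close>

text \<open>This is \<open>u\<^sup>r/r!\<close> combined with \<open>r! \<ge> (r/e)\<^sup>r\<close>, the latter being the \<open>r\<close>-th term of the
  exponential series at \<open>r\<close>.\<close>

lemma binomial_le_exp_power:
  assumes "r \<ge> 1"
  shows "real (u choose r) \<le> (exp 1 * u / r) ^ r"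
proof -
  have "real r ^ r / fact r \<le> exp r"
  proof -
    have "(\<Sum>i<Suc r. real r ^ i / fact i) \<le> (\<Sum>i. real r ^ i / fact i)"
      using summable_exp[of "real r"]
      by (intro sum_le_suminf) (auto simp: field_simps)
    also have "\<dots> = exp r"
      by (simp add: exp_def scaleR_conv_of_real divide_inverse mult.commute)
    finally have "(\<Sum>i<r. real r ^ i / fact i) + real r ^ r / fact r \<le> exp r"
      by simp
    moreover have "(\<Sum>i<r. real r ^ i / fact i) \<ge> 0"
      by (intro sum_nonneg) auto
    ultimately show ?thesis by linarith
  qed
  then have "real r ^ r \<le> exp 1 ^ r * fact r"
    using exp_of_nat_mult[of r "1::real"] by (simp add: field_simps)
  then have "(u choose r) * real r ^ r \<le> (u choose r) * (exp 1 ^ r * fact r)"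
    by (intro mult_left_mono) auto
  also have "\<dots> = exp 1 ^ r * real ((u choose r) * fact r)"
    by simp
  also have "\<dots> \<le> exp 1 ^ r * real (u ^ r)"
    by (intro mult_left_mono of_nat_mono binomial_fact_pow) auto
  finally show ?thesis
    using assms by (simp add: field_simps power_mult_distrib power_divide)
qed

text \<open>The count above, rewritten in terms of \<open>maxprod k n\<close>. Here \<open>d\<close> stands for \<open>k - k'\<close>. The
  exponent \<open>4\<close> is one \<open>e\<close> from the binomial coefficient and \<open>e\<^sup>3\<close> for each of the \<open>r\<close>
  corresponding added parts; the \<open>d + t\<close> other added parts give the factor in front.\<close>

lemma many_in_U_bound:
  fixes \<gamma> :: real
  assumes N: "N \<le> n ^ t * (u choose r) * maxprod m n"
    and u: "real u \<le> \<gamma> * n" and \<gamma>: "0 < \<gamma>"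
    and k: "k = d + t + r + m" and "m \<ge> 1" "r \<ge> 1" "k \<le> n"
  shows "real N \<le> exp (3 * real (d + t)) * real k ^ (d + t) * (exp 4 * \<gamma> * k / r) ^ r
    * (maxprod k n / real n ^ d)"
proof -
  define s where "s = d + t + r"
  have "n > 0"
    using assms by simp
  have "real N \<le> real (n ^ t * (u choose r) * maxprod m n)"
    using N by (rule of_nat_mono)
  also have "\<dots> = real n ^ t * real (u choose r) * maxprod m n"
    by simp
  also have "\<dots> \<le> real n ^ t * (exp 1 * (\<gamma> * n) / r) ^ r * maxprod m n"
  proof (intro mult_mono order.refl)
    have "real (u choose r) \<le> (exp 1 * u / r) ^ r"
      using \<open>r \<ge> 1\<close> by (rule binomial_le_exp_power)
    also have "\<dots> \<le> (exp 1 * (\<gamma> * n) / r) ^ r"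
      using u by (intro power_mono divide_right_mono mult_left_mono) auto
    finally show "real (u choose r) \<le> (exp 1 * (\<gamma> * n) / r) ^ r" .
  qed (use \<gamma> in auto)
  also have "\<dots> = (exp 1 * \<gamma> / r) ^ r * (real n ^ s * maxprod m n) / real n ^ d"
    using \<open>n > 0\<close> by (simp add: s_def power_add power_mult_distrib power_divide field_simps)
  also have "\<dots> \<le> (exp 1 * \<gamma> / r) ^ r * ((exp 3 * k) ^ s * maxprod k n) / real n ^ d"
    using maxprod_add[of m k n s] assms
    by (intro divide_right_mono mult_left_mono) (auto simp: s_def add_ac)
  also have "\<dots> = exp 3 ^ (d + t) * real k ^ (d + t) * ((exp 1 * exp 3) * \<gamma> * k / r) ^ r
      * (maxprod k n / real n ^ d)"
    by (simp add: s_def power_add power_mult_distrib power_divide mult_ac)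
  also have "exp 3 ^ (d + t) = exp (3 * real (d + t))"
    using exp_of_nat_mult[of "d + t" "3::real"] by (simp add: mult.commute)
  also have "exp 1 * exp 3 = exp (4::real)"
    by (simp flip: exp_add)
  finally show ?thesis .
qed

text \<open>With \<open>L = log k \<ge> 1\<close> and \<open>1/q > 2\<close> the exponent \<open>(3 + L)(d + t)\<close> is at most
  \<open>4L \<cdot> 7L/q\<close>.\<close>

lemma exp_power_le_exp_log_squared:
  fixes q :: real
  assumes q: "0 < q" "q < 1/2" and k: "k \<ge> 3" and d: "d \<le> 4" and t: "real t \<le> (5 / q) * ln k"
  shows "exp (3 * real (d + t)) * real k ^ (d + t) \<le> exp ((40 / q) * (ln k)\<^sup>2)"
proof -
  define L where "L = ln (real k)"
  have L: "L \<ge> 1"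
    unfolding L_def using k exp_le by (subst ln_ge_iff) auto
  have "exp (3 * real (d + t)) * real k ^ (d + t) = exp ((3 + L) * (d + t))"
  proof -
    have "real k ^ (d + t) = exp (L * (d + t))"
      using k exp_of_nat_mult[of "d + t" L] by (simp add: L_def mult.commute)
    then show ?thesis
      by (simp add: exp_add[symmetric] algebra_simps)
  qed
  also have "(3 + L) * (d + t) \<le> (3 + L) * (4 + (5 / q) * L)"
    using d t L by (intro mult_left_mono) (auto simp: L_def)
  also have "\<dots> \<le> (4 * L) * (7 * L / q)"
  proof (rule mult_mono)
    have "4 * 1 \<le> (2 / q) * L"
      using q L by (intro mult_mono) (auto simp: field_simps)
    moreover have "7 * L / q = (2 / q) * L + (5 / q) * L"
      using q by (simp add: field_simps)
    ultimately show "4 + (5 / q) * L \<le> 7 * L / q"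
      by linarith
  qed (use q L in auto)
  also have "\<dots> \<le> (40 / q) * L\<^sup>2"
    using q L by (simp add: field_simps power2_eq_square)
  finally show ?thesis
    by (simp add: L_def)
qed

text \<open>Since \<open>r \<ge> \<beta>k/2\<close>, the base is at most \<open>2e\<^sup>4\<gamma>/\<beta> < 1\<close>, so that lowering the exponent to
  \<open>\<beta>k/2\<close> only increases the power.\<close>

lemma power_le_powr_half:
  fixes \<gamma> \<beta> :: real
  assumes "0 < \<gamma>" "0 < \<beta>" "\<beta> * k / 2 \<le> r" "k > 0" and small: "2 * exp 4 * \<gamma> / \<beta> < 1"
  shows "(exp 4 * \<gamma> * k / real r) ^ r \<le> (2 * exp 4 * \<gamma> / \<beta>) powr (\<beta> * k / 2)"
proof -
  define b where "b = 2 * exp 4 * \<gamma> / \<beta>"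
  have b: "0 < b" "b < 1"
    using assms by (auto simp: b_def)
  have r: "real r > 0"
    using assms by (smt (verit) divide_pos_pos mult_pos_pos)
  have "exp 4 * \<gamma> * k / real r \<le> exp 4 * \<gamma> * k / (\<beta> * k / 2)"
    using assms r by (intro divide_left_mono) auto
  also have "\<dots> = b"
    using assms by (simp add: b_def)
  finally have "(exp 4 * \<gamma> * k / real r) ^ r \<le> b ^ r"
    using assms by (intro power_mono) auto
  also have "\<dots> = b powr r"
    using b by (simp add: powr_realpow)
  also have "\<dots> \<le> b powr (\<beta> * k / 2)"
    using b assms(3) by (intro powr_mono') auto
  finally show ?thesis
    by (simp add: b_def)
qed

section \<open>Embeddings with many vertices in a small set\<close>

theorem lemma7p9:
  fixes q :: real
  assumes "0 < q" and "q < 1/2"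
  shows "\<exists>k\<^sub>0::nat. \<forall>k\<ge>k\<^sub>0.
    \<forall>(H :: 'a sgraph) (H' :: 'a sgraph) (G :: 'b sgraph) (U :: 'b set)
      (n::nat) (k'::nat) (\<gamma>::real) (\<beta>::real).
      simple_graph H \<and> card (verts H) = k \<and>
      (\<forall>x \<in> verts H. \<forall>y \<in> verts H. x \<noteq> y \<longrightarrow>
         q * real k \<le> real (card {w \<in> verts H - {x, y}. adj_exactly_one H w x y})) \<and>
      induced_subgraph H' H \<and> card (verts H') = k' \<and> int k' \<ge> int k - 4 \<and>
      simple_graph G \<and> card (verts G) = n \<and> n \<ge> k \<and>
      0 < \<gamma> \<and> \<gamma> < 1 \<and>
      U \<subseteq> verts G \<and> real (card U) \<le> \<gamma> * real n \<and>
      0 < \<beta> \<and> \<beta> \<le> q / 3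
      \<longrightarrow>
      (\<exists>T. signature H T \<and> T \<subseteq> verts H' \<and>
        (let t = card T;
             r = \<lceil>\<beta> * real k\<rceil> - int t;
             d\<^sub>0 = k - k' + t;
             N = card {\<theta> \<in> embeddings H' G. real (card (emb_preimage H' \<theta> U)) \<ge> \<beta> * real k}
         in
           real t \<le> (5 / q) * ln (real k) \<and>
           int k' - int t - r \<ge> 1 \<and>
           (r \<ge> 1 \<longrightarrow>
              real N \<le> exp (3 * real d\<^sub>0) * real k ^ d\<^sub>0
                * (exp 4 * \<gamma> * real k / real_of_int r) powi r
                * (real (maxprod k n) / real n ^ (k - k'))) \<and>
           (\<beta> * real k \<ge> 2 * real t + 2 \<and> 2 * exp 4 * \<gamma> / \<beta> < 1 \<longrightarrow>
              real N \<le> exp ((40 / q) * (ln (real k))\<^sup>2)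
                * (2 * exp 4 * \<gamma> / \<beta>) powr (\<beta> * real k / 2)
                * (real (maxprod k n) / real n ^ (k - k')))))"
proof (intro exI[of _ "nat \<lceil>8 / q\<rceil>"] allI impI, elim conjE)
  fix k :: nat and H H' :: "'a sgraph" and G :: "'b sgraph" and U :: "'b set"
    and n k' :: nat and \<gamma> \<beta> :: real
  assume "nat \<lceil>8 / q\<rceil> \<le> k"
  assume H: "simple_graph H" "card (verts H) = k"
    and sep: "\<forall>x \<in> verts H. \<forall>y \<in> verts H. x \<noteq> y \<longrightarrow>
         q * real k \<le> real (card {w \<in> verts H - {x, y}. adj_exactly_one H w x y})"
    and H': "induced_subgraph H' H" "card (verts H') = k'" "int k' \<ge> int k - 4"
    and G: "simple_graph G" "card (verts G) = n" "n \<ge> k"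
    and \<gamma>: "0 < \<gamma>" "\<gamma> < 1" and U: "U \<subseteq> verts G" "real (card U) \<le> \<gamma> * real n"
    and \<beta>: "0 < \<beta>" "\<beta> \<le> q / 3"
  have k8: "8 / q \<le> k"
    using \<open>nat \<lceil>8 / q\<rceil> \<le> k\<close> by linarith
  moreover have "8 / q > 16"
    using assms by (simp add: field_simps)
  ultimately have k16: "k > 16"
    by linarith
  have sub: "verts H' \<subseteq> verts H"
    using H'(1) by (simp add: induced_subgraph_def)
  have finH: "finite (verts H)" "finite (verts H')" and finG: "finite (verts G)"
    using H(1) G(1) sub by (auto simp: simple_graph_def finite_subset)
  have k': "k' \<le> k" "k - k' \<le> 4"
    using card_mono[OF finH(1) sub] H(2) H'(2,3) by auto
  have big: "k \<le> card (verts H') + 4"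
    using H'(2,3) by linarith
  obtain T where T: "T \<subseteq> verts H'" "signature H T" "real (card T) \<le> (5 / q) * ln k"
    using small_signature[OF assms H k8 _ sub big] sep by blast
  have adj_H': "adj H' u v \<longleftrightarrow> adj H u v" if "u \<in> verts H'" "v \<in> verts H'" for u v
    using that H'(1) by (auto simp: adj_def induced_subgraph_def)
  have TH': "signature H' T"
    unfolding signature_def
  proof (intro conjI ballI impI)
    fix u v assume uv: "u \<in> verts H' - T" "v \<in> verts H' - T" "u \<noteq> v"
    then obtain s where s: "s \<in> T" "adj_exactly_one H s u v"
      using T(2) sub unfolding signature_def by blast
    moreover from s(1) have "s \<in> verts H'"
      using T(1) by blast
    ultimately show "\<exists>s\<in>T. adj_exactly_one H' s u v"
      using uv adj_H' unfolding adj_exactly_one_def by blast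
  qed (rule T(1))
  define t where "t = card T"
  define r where "r = \<lceil>\<beta> * real k\<rceil> - int t"
  define Emb where "Emb = {\<theta> \<in> embeddings H' G. real (card (emb_preimage H' \<theta> U)) \<ge> \<beta> * real k}"
  \<comment> \<open>Here \<open>t\<close> cancels, and \<open>\<beta>k \<le> k/6\<close> leaves ample room once \<open>k > 16\<close>.\<close>
  have gap: "int k' - int t - r \<ge> 1"
  proof -
    have "\<beta> * k \<le> 1 / 6 * k"
      using \<beta> assms by (intro mult_right_mono) auto
    then show ?thesis
      unfolding r_def using k16 H'(3) by linarith
  qed
  have first: "real (card Emb) \<le> exp (3 * real (k - k' + t)) * real k ^ (k - k' + t)
      * (exp 4 * \<gamma> * k / rn) ^ rn * (real (maxprod k n) / real n ^ (k - k'))"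
    if rn: "r = int rn" "rn \<ge> 1" for rn
  proof (rule many_in_U_bound[OF _ U(2) \<gamma>(1) _ _ rn(2) G(3)])
    define m where "m = k' - t - rn"
    show m: "m \<ge> 1" "k = (k - k') + t + rn + m"
      using gap rn k' by (auto simp: m_def)
    have "Emb \<subseteq> {\<theta> \<in> embeddings H' G. rn \<le> card (emb_preimage H' \<theta> U - T)}"
    proof
      fix \<theta> assume \<theta>: "\<theta> \<in> Emb"
      then have "\<beta> * k \<le> card (emb_preimage H' \<theta> U)"
        by (simp add: Emb_def)
      moreover have "card (emb_preimage H' \<theta> U) - t \<le> card (emb_preimage H' \<theta> U - T)"
        unfolding t_def using T(1) finH(2) by (intro diff_card_le_card_Diff) (auto intro: finite_subset)
      ultimately have "rn \<le> card (emb_preimage H' \<theta> U - T)"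
        using rn(1) unfolding r_def by linarith
      then show "\<theta> \<in> {\<theta> \<in> embeddings H' G. rn \<le> card (emb_preimage H' \<theta> U - T)}"
        using \<theta> by (simp add: Emb_def)
    qed
    moreover have "finite (embeddings H' G)"
      using finH(2) finG by (auto simp: embeddings_def intro!: finite_PiE)
    ultimately have "card Emb \<le> card {\<theta> \<in> embeddings H' G. rn \<le> card (emb_preimage H' \<theta> U - T)}"
      by (intro card_mono) auto
    also have "\<dots> \<le> n ^ t * (card U choose rn) * maxprod m n"
      using m k'(1) H'(2)
      by (intro card_embeddings_meeting_U_le finH(2) finG G(2) TH' U(1)) (auto simp: t_def)
    finally show "card Emb \<le> n ^ t * (card U choose rn) * maxprod m n" .
  qed
  have part1: "real (card Emb) \<le> exp (3 * real (k - k' + t)) * real k ^ (k - k' + t)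
      * (exp 4 * \<gamma> * k / of_int r) powi r * (real (maxprod k n) / real n ^ (k - k'))" if "r \<ge> 1"
    using first[of "nat r"] that by (simp add: power_int_def)
  have part2: "real (card Emb) \<le> exp ((40 / q) * (ln k)\<^sup>2)
      * (2 * exp 4 * \<gamma> / \<beta>) powr (\<beta> * k / 2) * (real (maxprod k n) / real n ^ (k - k'))"
    if large: "\<beta> * k \<ge> 2 * t + 2" and small: "2 * exp 4 * \<gamma> / \<beta> < 1"
  proof -
    define rn where "rn = nat r"
    have half: "\<beta> * k / 2 + 1 \<le> r"
      using large unfolding r_def by linarith
    moreover have "\<beta> * k / 2 \<ge> 0"
      using \<beta> by simp
    ultimately have rn: "r = int rn" "rn \<ge> 1" "\<beta> * k / 2 \<le> rn"
      unfolding rn_def by linarith+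
    have "exp (3 * real (k - k' + t)) * real k ^ (k - k' + t) * (exp 4 * \<gamma> * k / rn) ^ rn
      \<le> exp ((40 / q) * (ln k)\<^sup>2) * (2 * exp 4 * \<gamma> / \<beta>) powr (\<beta> * k / 2)"
      using k16 T(3) k'(2) \<gamma> \<beta> rn(3) small assms
      by (intro mult_mono exp_power_le_exp_log_squared power_le_powr_half) (auto simp: t_def)
    from mult_right_mono[OF this, of "real (maxprod k n) / real n ^ (k - k')"]
    show ?thesis
      using first[OF rn(1,2)] by simp
  qed
  show "\<exists>T. signature H T \<and> T \<subseteq> verts H' \<and>
        (let t = card T;
             r = \<lceil>\<beta> * real k\<rceil> - int t;
             d\<^sub>0 = k - k' + t;
             N = card {\<theta> \<in> embeddings H' G. real (card (emb_preimage H' \<theta> U)) \<ge> \<beta> * real k}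
         in
           real t \<le> (5 / q) * ln (real k) \<and>
           int k' - int t - r \<ge> 1 \<and>
           (r \<ge> 1 \<longrightarrow>
              real N \<le> exp (3 * real d\<^sub>0) * real k ^ d\<^sub>0
                * (exp 4 * \<gamma> * real k / real_of_int r) powi r
                * (real (maxprod k n) / real n ^ (k - k'))) \<and>
           (\<beta> * real k \<ge> 2 * real t + 2 \<and> 2 * exp 4 * \<gamma> / \<beta> < 1 \<longrightarrow>
              real N \<le> exp ((40 / q) * (ln (real k))\<^sup>2)
                * (2 * exp 4 * \<gamma> / \<beta>) powr (\<beta> * real k / 2)
                * (real (maxprod k n) / real n ^ (k - k'))))"
    unfolding Let_def t_def[symmetric] r_def[symmetric] Emb_def[symmetric]
    by (rule exI[of _ T], unfold t_def[symmetric] r_def[symmetric] Emb_def[symmetric])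
       (use T gap part1 part2 in \<open>simp add: t_def\<close>)
qed

end
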